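(* Let $\mathsf{M}$ be a matroid on $[n]$, let $f\in\mathrm{PLaur}(\Sigma_n)^*$ be a piecewise Laurent monomial, and let $T$ be a nonempty proper subset of $[n]$. Then $$Q_{\mathsf{M}}(f)=Q_{\mathsf{M}}(f_T)+Q_{\mathsf{M}|T}(f|T)\cdot Q_{\mathsf{M}/T}(f/T),$$ where $\mathsf{M}|T$ is the restriction of $\mathsf{M}$ to $T$ and $\mathsf{M}/T$ is the contraction of $\mathsf{M}$ by $T$.
   Context: Let $E$ be a finite nonempty set of size $n$. $S_E$ is the set of bijections $\sigma:[n]\to E$, $[n]=\{1,\dots,n\}$, and $S_n=S_{[n]}$; $\tau_i\in S_n$ is the adjacent transposition swapping $i$ and $i+1$. A piecewise Laurent polynomial on the braid fan $\Sigma_E$ is a collection $f=\{f_\sigma:\sigma\in S_E\}$ with $f_\sigma\in\mathbb{Z}[x_e^{\pm1}:e\in E]$ such that for all $\sigma\in S_E$, $i\in[n-1]$, $f_\sigma-f_{\sigma\circ\tau_i}$ is divisible in $\mathbb{Z}[x_e^{\pm1}:e\in E]$ by $x_{\sigma(i)}-x_{\sigma(i+1)}$; these form the ring $\mathrm{PLaur}(\Sigma_E)$. A piecewise Laurent monomial is such a collection in which every $f_\sigma$ is a monomial $x^{m_\sigma}=\prod_{e\in E}x_e^{(m_\sigma)_e}$ with $m_\sigma\in\mathbb{Z}^E$; these form a multiplicative group $\mathrm{PLaur}(\Sigma_E)^*$. Write $\Sigma_n=\Sigma_{[n]}$. For a matroid $\mathsf{M}$ on $E$ with rank function $\mathrm{rk}_{\mathsf{M}}$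 and $\sigma\in S_E$, the greedy basis is $$B_{\mathsf{M}}(\sigma)=\{\sigma(i): \mathrm{rk}_{\mathsf{M}}\{\sigma(1),\dots,\sigma(i)\}>\mathrm{rk}_{\mathsf{M}}\{\sigma(1),\dots,\sigma(i-1)\}\}.$$ For $f\in\mathrm{PLaur}(\Sigma_E)$, $$Q_{\mathsf{M}}(f)=\sum_{\sigma\in S_E} f_\sigma\, Q(C_\sigma)\prod_{i\in E\setminus B_{\mathsf{M}}(\sigma)}(1-x_i)\in \mathbb{Z}(x_e:e\in E),\qquad Q(C_\sigma)=\frac{1}{\prod_{i=1}^{n-1}\left(1-\frac{x_{\sigma(i+1)}}{x_{\sigma(i)}}\right)}.$$ Let $T$ be a nonempty proper subset of $E$ with $|T|=k$, $T^c=E\setminus T$, and $S_{E,T}=\{\sigma\in S_E:\sigma(i)\in T\text{ for all }i\le k\}$. For $f\in\mathrm{PLaur}(\Sigma_E)^*$, the piecewise Laurent monomial $f_T\in\mathrm{PLaur}(\Sigma_E)^*$ is defined by $(f_T)_\sigma=f_\sigma$ if $\sigma\notin S_{E,T}$ and $(f_T)_\sigma=\frac{x_{\sigma(k+1)}}{x_{\sigma(k)}}f_\sigma$ if $\sigma\in S_{E,T}$. For $\sigma\in S_{E,T}$ define bijections $\sigma|T:[k]\to T$ and $\sigma/T:[n-k]\to T^c$ by $(\sigma|T)(i)=\sigma(i)$ and $(\sigma/T)(i)=\sigma(i+k)$; the map $\sigma\mapsto(\sigma|T,\sigma/T)$ is a bijection $S_{E,T}\to S_T\times S_{T^c}$.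 The piecewise Laurent monomials $f|T\in\mathrm{PLaur}(\Sigma_T)^*$ and $f/T\in\mathrm{PLaur}(\Sigma_{T^c})^*$ are defined by: for any $\sigma\in S_{E,T}$, $(f|T)_{\sigma|T}$ is $f_\sigma$ with $x_i=1$ for all $i\notin T$, and $(f/T)_{\sigma/T}$ is $f_\sigma$ with $x_i=1$ for all $i\in T$ (these are well defined, i.e. independent of the choice of $\sigma$ with given $\sigma|T$, respectively $\sigma/T$). The bases of $\mathsf{M}|T$ (a matroid on $T$) are the maximal independent subsets of $T$; the bases of $\mathsf{M}/T$ (a matroid on $T^c$) are the sets $B\setminus T$ with $B$ a basis of $\mathsf{M}$ such that $B\cap T$ is a basis of $\mathsf{M}|T$. In the theorem $E=[n]$. *)

theory Defs
  imports
    "HOL-Library.Poly_Mapping"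
    "HOL-Library.FuncSet"
    "HOL-Combinatorics.Transposition"
    "HOL-Computational_Algebra.Polynomial_Factorial"
begin

section \<open>Laurent polynomials\<close>

text \<open>
  The group ring of the finitely supported integer vectors indexed by \<open>'e\<close>, i.e. integral Laurent
  polynomials in the variables \<open>x\<^sub>e\<close> for all \<open>e :: 'e\<close>.  The Laurent polynomial ring over a set
  \<open>E\<close> of variables is the subring \<open>Laurent E\<close>, and the field of rational functions in the variables
  from \<open>E\<close> is a subfield of \<open>'e laurent fract\<close>.  The order on \<open>'e\<close> is needed only for
  the library's instance making \<open>'e laurent\<close> an integral domain.
\<close>

type_synonym 'e laurent = "('e \<Rightarrow>\<^sub>0 int) \<Rightarrow>\<^sub>0 int"

definition Laurent :: "'e set \<Rightarrow> 'e laurent set" where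
  "Laurent E = {p. \<forall>m \<in> Poly_Mapping.keys p. Poly_Mapping.keys m \<subseteq> E}"

definition monomial :: "('e \<Rightarrow>\<^sub>0 int) \<Rightarrow> 'e laurent" where
  "monomial m = Poly_Mapping.single m 1"

definition var :: "'e \<Rightarrow> 'e laurent" where
  "var e = monomial (Poly_Mapping.single e 1)"

definition var_inv :: "'e \<Rightarrow> 'e laurent" where
  "var_inv e = monomial (Poly_Mapping.single e (- 1))"

abbreviation rvar :: "'e::linorder \<Rightarrow> 'e laurent fract" where
  "rvar e \<equiv> to_fract (var e)"

text \<open>Substituting \<open>x\<^sub>e = 1\<close> for all \<open>e \<in> A\<close>.\<close>

definition set_to_one :: "'e set \<Rightarrow> 'e laurent \<Rightarrow> 'e laurent" where
  "set_to_one A p =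
     (\<Sum>m \<in> Poly_Mapping.keys p.
        Poly_Mapping.single (Poly_Mapping.mapp (\<lambda>e a. if e \<in> A then 0 else a) m)
          (Poly_Mapping.lookup p m))"


section \<open>Piecewise Laurent polynomials on the braid fan\<close>

text \<open>
  Orderings are extensional, so that \<open>orderings E\<close> is the finite set of bijections from
  \<open>{1..card E}\<close> to \<open>E\<close>.  A family indexed by \<open>orderings E\<close> is a function on the ambient type;
  its values at other arguments are irrelevant.
\<close>

definition orderings :: "'e set \<Rightarrow> (nat \<Rightarrow> 'e) set" where
  "orderings E = {\<sigma> \<in> {1..card E} \<rightarrow>\<^sub>E E. bij_betw \<sigma> {1..card E} E}"

type_synonym 'e family = "(nat \<Rightarrow> 'e) \<Rightarrow> 'e laurent"

definition PLaur :: "'e set \<Rightarrow> 'e family set" where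
  "PLaur E =
     {f. (\<forall>\<sigma> \<in> orderings E. f \<sigma> \<in> Laurent E) \<and>
         (\<forall>\<sigma> \<in> orderings E. \<forall>i \<in> {1..card E - 1}. \<exists>q \<in> Laurent E.
            f \<sigma> - f (\<sigma> \<circ> transpose i (i + 1)) = (var (\<sigma> i) - var (\<sigma> (i + 1))) * q)}"

definition PLaur_monomials :: "'e set \<Rightarrow> 'e family set" where
  "PLaur_monomials E =
     {f \<in> PLaur E. \<forall>\<sigma> \<in> orderings E. \<exists>m. Poly_Mapping.keys m \<subseteq> E \<and> f \<sigma> = monomial m}"

definition orderings_first :: "'e set \<Rightarrow> 'e set \<Rightarrow> (nat \<Rightarrow> 'e) set" where
  "orderings_first E T = {\<sigma> \<in> orderings E. \<forall>i \<in> {1..card T}. \<sigma> i \<in> T}"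

definition family_twist :: "'e set \<Rightarrow> 'e set \<Rightarrow> 'e family \<Rightarrow> 'e family" where
  "family_twist E T f = (\<lambda>\<sigma>.
     if \<sigma> \<in> orderings_first E T
     then var (\<sigma> (card T + 1)) * var_inv (\<sigma> (card T)) * f \<sigma>
     else f \<sigma>)"

definition ordering_restrict :: "'e set \<Rightarrow> (nat \<Rightarrow> 'e) \<Rightarrow> nat \<Rightarrow> 'e" where
  "ordering_restrict T \<sigma> = restrict \<sigma> {1..card T}"

definition ordering_contract :: "'e set \<Rightarrow> 'e set \<Rightarrow> (nat \<Rightarrow> 'e) \<Rightarrow> nat \<Rightarrow> 'e" where
  "ordering_contract E T \<sigma> = (\<lambda>i \<in> {1..card E - card T}. \<sigma> (i + card T))"

text \<open>
  The next two definitions are meaningful for \<open>f \<in> PLaur_monomials E\<close> and \<open>T\<close> a nonempty proper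
  subset of \<open>E\<close>: then the value is independent of the choice of \<open>\<sigma>\<close>.
\<close>

definition family_restrict :: "'e set \<Rightarrow> 'e set \<Rightarrow> 'e family \<Rightarrow> 'e family" where
  "family_restrict E T f = (\<lambda>\<pi>. THE p.
     \<forall>\<sigma> \<in> orderings_first E T. ordering_restrict T \<sigma> = \<pi> \<longrightarrow> p = set_to_one (E - T) (f \<sigma>))"

definition family_contract :: "'e set \<Rightarrow> 'e set \<Rightarrow> 'e family \<Rightarrow> 'e family" where
  "family_contract E T f = (\<lambda>\<pi>. THE p.
     \<forall>\<sigma> \<in> orderings_first E T. ordering_contract E T \<sigma> = \<pi> \<longrightarrow> p = set_to_one T (f \<sigma>))"


section \<open>Matroids\<close>

record 'e set_system =
  ground :: "'e set"
  bases :: "'e set set"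

definition matroid :: "'e set_system \<Rightarrow> bool" where
  "matroid M \<longleftrightarrow>
     finite (ground M) \<and> bases M \<noteq> {} \<and> (\<forall>B \<in> bases M. B \<subseteq> ground M) \<and>
     (\<forall>B1 \<in> bases M. \<forall>B2 \<in> bases M. \<forall>x \<in> B1 - B2. \<exists>y \<in> B2 - B1.
        insert y (B1 - {x}) \<in> bases M)"

definition indep :: "'e set_system \<Rightarrow> 'e set \<Rightarrow> bool" where
  "indep M I \<longleftrightarrow> (\<exists>B \<in> bases M. I \<subseteq> B)"

definition rank :: "'e set_system \<Rightarrow> 'e set \<Rightarrow> nat" where
  "rank M X = Max (card ` {I. I \<subseteq> X \<and> indep M I})"

definition matroid_restrict :: "'e set_system \<Rightarrow> 'e set \<Rightarrow> 'e set_system" where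
  "matroid_restrict M T =
     \<lparr>ground = T,
      bases = {I. I \<subseteq> T \<and> indep M I \<and> (\<forall>J. J \<subseteq> T \<and> indep M J \<and> I \<subseteq> J \<longrightarrow> J = I)}\<rparr>"

definition matroid_contract :: "'e set_system \<Rightarrow> 'e set \<Rightarrow> 'e set_system" where
  "matroid_contract M T =
     \<lparr>ground = ground M - T,
      bases = {B - T |B. B \<in> bases M \<and> B \<inter> T \<in> bases (matroid_restrict M T)}\<rparr>"

definition greedy_basis :: "'e set_system \<Rightarrow> (nat \<Rightarrow> 'e) \<Rightarrow> 'e set" where
  "greedy_basis M \<sigma> =
     {\<sigma> i |i. i \<in> {1..card (ground M)} \<and> rank M (\<sigma> ` {1..i}) > rank M (\<sigma> ` {1..i - 1})}"


section \<open>The rational function \<open>Q\<close>\<close>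

definition Q_cone :: "'e::linorder set \<Rightarrow> (nat \<Rightarrow> 'e) \<Rightarrow> 'e laurent fract" where
  "Q_cone E \<sigma> = 1 / (\<Prod>i \<in> {1..card E - 1}. 1 - rvar (\<sigma> (i + 1)) / rvar (\<sigma> i))"

definition Q_matroid :: "'e::linorder set_system \<Rightarrow> 'e family \<Rightarrow> 'e laurent fract" where
  "Q_matroid M f =
     (\<Sum>\<sigma> \<in> orderings (ground M).
        to_fract (f \<sigma>) * Q_cone (ground M) \<sigma> *
        (\<Prod>e \<in> ground M - greedy_basis M \<sigma>. 1 - rvar e))"

end

theory Submission
  imports Defs "HOL-Combinatorics.Permutations"
begin

text \<open>
  The summands of \<open>Q M f - Q M f\<^sub>T\<close> vanish outside \<open>orderings_first E T\<close>.  For \<open>\<sigma>\<close> in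
  \<open>orderings_first E T\<close>, with \<open>k = |T|\<close>, the twist contributes the factor
  \<open>1 - x(\<sigma>(k+1)) / x(\<sigma>(k))\<close>, which cancels exactly the factor of \<open>Q(C\<^sub>\<sigma>)\<close>
  linking \<open>T\<close> to its complement, so what remains of \<open>Q(C\<^sub>\<sigma>)\<close> is a product over the two blocks.
  The greedy basis splits because the rank of \<open>T \<union> X\<close> is the rank of \<open>T\<close> plus the rank of \<open>X\<close>
  in the contraction, and the monomial \<open>f\<^sub>\<sigma>\<close> is the product of its parts in the variables of
  \<open>T\<close> and of the complement.
\<close>

subsection \<open>Ranks in restrictions and contractions\<close>

lemma matroid_finite_basis: "matroid M \<Longrightarrow> B \<in> bases M \<Longrightarrow> finite B"
  unfolding matroid_def by (meson finite_subset)

lemma matroid_exchange: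
  assumes "matroid M" "B1 \<in> bases M" "B2 \<in> bases M" "x \<in> B1 - B2"
  obtains y where "y \<in> B2 - B1" "insert y (B1 - {x}) \<in> bases M"
  using assms unfolding matroid_def by blast

lemma indep_subset: "indep M J \<Longrightarrow> I \<subseteq> J \<Longrightarrow> indep M I"
  unfolding indep_def by blast

lemma indep_finite: "matroid M \<Longrightarrow> indep M I \<Longrightarrow> finite I"
  unfolding indep_def by (meson matroid_finite_basis finite_subset)

lemma indep_basis: "B \<in> bases M \<Longrightarrow> indep M B"
  unfolding indep_def by blast

lemma indep_empty: "matroid M \<Longrightarrow> indep M {}"
  unfolding indep_def matroid_def by blast

text \<open>Exchanging an element of \<open>B1\<close> outside \<open>B2\<close> for one of
  \<open>B2\<close> preserves the size and shrinks \<open>B1 - B2\<close>; when nothing is left to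
  exchange, \<open>B1\<close> is contained in \<open>B2\<close>.\<close>

lemma card_basis_le:
  assumes M: "matroid M" and "B1 \<in> bases M" "B2 \<in> bases M"
  shows "card B1 \<le> card B2"
  using assms(2)
proof (induction "card (B1 - B2)" arbitrary: B1)
  case 0
  then have "B1 \<subseteq> B2"
    using matroid_finite_basis[OF M] by simp
  then show ?case
    using matroid_finite_basis[OF M \<open>B2 \<in> bases M\<close>] by (simp add: card_mono)
next
  case (Suc d)
  have fin: "finite B1"
    using M Suc.prems by (rule matroid_finite_basis)
  obtain x where x: "x \<in> B1 - B2"
    using Suc.hyps(2) by (metis card.empty equals0I nat.distinct(1))
  obtain y where y: "y \<in> B2 - B1" "insert y (B1 - {x}) \<in> bases M"
    using matroid_exchange[OF M Suc.prems \<open>B2 \<in> bases M\<close> x] .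
  have "insert y (B1 - {x}) - B2 = (B1 - B2) - {x}"
    using y by auto
  then have "card (insert y (B1 - {x}) - B2) = d"
    using Suc.hyps(2) fin x by (simp add: card_Diff_singleton)
  then have "card (insert y (B1 - {x})) \<le> card B2"
    using Suc.hyps(1) y(2) by blast
  moreover have "card (insert y (B1 - {x})) = card B1"
    using fin x y(1) card_Suc_Diff1[OF fin, of x] by simp
  ultimately show ?case by simp
qed

lemma card_basis_eq:
  assumes "matroid M" "B1 \<in> bases M" "B2 \<in> bases M"
  shows "card B1 = card B2"
  using assms by (simp add: card_basis_le le_antisym)

text \<open>
  If no element of \<open>J\<close> augments \<open>I\<close>, exchanges away from \<open>I\<close> and \<open>J\<close> reduce to bases
  \<open>B1 \<supseteq> I\<close>, \<open>B2 \<supseteq> J\<close> with \<open>B2 - B1 = J - I\<close> and \<open>B1 - B2 \<subseteq> I - J\<close>, which contradicts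
  equicardinality.
\<close>

lemma indep_augment:
  assumes M: "matroid M" and I: "indep M I" and J: "indep M J" and less: "card I < card J"
  shows "\<exists>y \<in> J - I. indep M (insert y I)"
proof (rule ccontr)
  assume no: "\<not> ?thesis"
  obtain B1 where B1: "B1 \<in> bases M" "I \<subseteq> B1"
    using I unfolding indep_def by blast
  \<comment> \<open>A \<open>y\<close> in \<open>J\<close> and \<open>B1\<close> but not in
    \<open>I\<close> would augment \<open>I\<close>, because \<open>insert y I\<close> stays inside
    the basis \<open>B1\<close>.\<close>
  have JB1: "J - B1 = J - I"
    using no B1 unfolding indep_def by blast
  have "\<exists>B2 \<in> bases M. J \<subseteq> B2 \<and> B2 \<subseteq> J \<union> B1"
  proof -
    obtain B where "B \<in> bases M" "J \<subseteq> B"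
      using J unfolding indep_def by blast
    then show ?thesis
    proof (induction "card (B - (J \<union> B1))" arbitrary: B)
      case 0
      then have "B \<subseteq> J \<union> B1"
        using matroid_finite_basis[OF M] by simp
      with 0 show ?case by blast
    next
      case (Suc d)
      have fin: "finite B"
        using M Suc.prems(1) by (rule matroid_finite_basis)
      obtain x where x: "x \<in> B - (J \<union> B1)"
        using Suc.hyps(2) by (metis card.empty equals0I nat.distinct(1))
      obtain y where y: "y \<in> B1 - B" "insert y (B - {x}) \<in> bases M"
        using matroid_exchange[OF M Suc.prems(1) B1(1)] x by blast
      have "insert y (B - {x}) - (J \<union> B1) = (B - (J \<union> B1)) - {x}"
        using y by auto
      then have "card (insert y (B - {x}) - (J \<union> B1)) = d"
        using Suc.hyps(2) fin x by (simp add: card_Diff_singleton)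
      moreover have "J \<subseteq> insert y (B - {x})"
        using Suc.prems(2) x by blast
      ultimately show ?case
        using Suc.hyps(1) y(2) by blast
    qed
  qed
  then obtain B2 where B2: "B2 \<in> bases M" "J \<subseteq> B2" "B2 \<subseteq> J \<union> B1"
    by blast
  have B21: "B2 - B1 = J - I"
    using B2 JB1 by blast
  have "B1 - B2 \<subseteq> I - J"
  proof
    fix x assume x: "x \<in> B1 - B2"
    obtain y where y: "y \<in> B2 - B1" "insert y (B1 - {x}) \<in> bases M"
      using matroid_exchange[OF M B1(1) B2(1) x] .
    have "y \<in> J - I"
      using y B21 by blast
    \<comment> \<open>Since \<open>y\<close> cannot augment \<open>I\<close>, removing
      \<open>x\<close> from \<open>B1\<close> must have removed an element of \<open>I\<close>.
      Moreover \<open>x\<close> is outside \<open>J\<close>, because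
      \<open>J \<subseteq> B2\<close>.\<close>
    then have "\<not> insert y I \<subseteq> insert y (B1 - {x})"
      using no y(2) unfolding indep_def by blast
    then show "x \<in> I - J"
      using B1 B2 x by blast
  qed
  then have "card (B1 - B2) \<le> card (I - J)"
    using indep_finite[OF M I] by (simp add: card_mono)
  moreover have "card (B1 - B2) = card (J - I)"
    using card_basis_eq[OF M B1(1) B2(1)] B21 card_le_sym_Diff[of B1 B2] card_le_sym_Diff[of B2 B1]
      matroid_finite_basis[OF M] B1(1) B2(1) by (metis le_antisym order_refl)
  ultimately have "card (J - I) \<le> card (I - J)" by simp
  then show False
    using less card_less_sym_Diff[of I J] indep_finite[OF M] I J by (meson leD)
qed

section \<open>Ranks and extension of independent sets\<close>

lemma finite_indep_subsets: "finite X \<Longrightarrow> finite {I. I \<subseteq> X \<and> indep M I}"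
  by (simp add: finite_subset[of _ "Pow X"] subset_iff)

lemma card_le_rank:
  assumes "finite X" "I \<subseteq> X" "indep M I"
  shows "card I \<le> rank M X"
  unfolding rank_def using assms finite_indep_subsets by (intro Max_ge) auto

lemma rank_witness:
  assumes "matroid M" "finite X"
  obtains I where "I \<subseteq> X" "indep M I" "card I = rank M X"
proof -
  have "rank M X \<in> card ` {I. I \<subseteq> X \<and> indep M I}"
    unfolding rank_def using assms finite_indep_subsets[of X M] indep_empty[of M]
    by (intro Max_in) auto
  then show ?thesis using that by auto
qed

text \<open>An independent \<open>K \<subseteq> X\<close> of maximum size supplies augmenting
  elements until the size reaches the rank, so the growing set never leaves \<open>X\<close>. The
  induction runs on the deficit \<open>rank M X - card I\<close>.\<close>

lemma indep_extend:
  assumes M: "matroid M" and "finite X" "I \<subseteq> X" "indep M I"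
  obtains J where "I \<subseteq> J" "J \<subseteq> X" "indep M J" "card J = rank M X"
proof -
  obtain K where K: "K \<subseteq> X" "indep M K" "card K = rank M X"
    using rank_witness[OF M \<open>finite X\<close>] .
  have "\<exists>J. I \<subseteq> J \<and> J \<subseteq> X \<and> indep M J \<and> card J = rank M X"
    using assms(3,4)
  proof (induction "rank M X - card I" arbitrary: I)
    case 0
    then have "card I = rank M X"
      using card_le_rank[OF \<open>finite X\<close> 0(2,3)] by simp
    with 0 show ?case by blast
  next
    case (Suc d)
    then obtain y where y: "y \<in> K - I" "indep M (insert y I)"
      using indep_augment[OF M _ K(2)] K(3) by (metis zero_less_Suc zero_less_diff)
    have "d = rank M X - card (insert y I)"
      using y(1) Suc.hyps(2) indep_finite[OF M Suc.prems(2)] by simp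
    moreover have "insert y I \<subseteq> X"
      using y(1) K(1) Suc.prems(1) by blast
    ultimately have "\<exists>J. insert y I \<subseteq> J \<and> J \<subseteq> X \<and> indep M J \<and> card J = rank M X"
      using y(2) by (intro Suc.hyps(1))
    then show ?case by blast
  qed
  then show ?thesis using that by blast
qed

text \<open>Every independent subset of \<open>T\<close> extends to one of size
  \<open>rank M T\<close>, so maximality under inclusion and maximum size coincide. Arguments about
  the restriction can then count instead of comparing sets.\<close>

lemma bases_restrict_iff:
  assumes M: "matroid M" and "finite T"
  shows "I \<in> bases (matroid_restrict M T) \<longleftrightarrow> I \<subseteq> T \<and> indep M I \<and> card I = rank M T"
proof
  assume "I \<in> bases (matroid_restrict M T)"
  then have I: "I \<subseteq> T" "indep M I" "\<And>J. J \<subseteq> T \<Longrightarrow> indep M J \<Longrightarrow> I \<subseteq> J \<Longrightarrow> J = I"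
    unfolding matroid_restrict_def by auto
  then show "I \<subseteq> T \<and> indep M I \<and> card I = rank M T"
    using indep_extend[OF M \<open>finite T\<close> I(1,2)] by metis
next
  assume I: "I \<subseteq> T \<and> indep M I \<and> card I = rank M T"
  have "J = I" if "J \<subseteq> T" "indep M J" "I \<subseteq> J" for J
    using that I card_le_rank[OF \<open>finite T\<close> that(1,2)] indep_finite[OF M that(2)]
    by (metis card_seteq)
  with I show "I \<in> bases (matroid_restrict M T)"
    unfolding matroid_restrict_def by auto
qed

lemma indep_restrict_iff:
  assumes M: "matroid M" and "finite T"
  shows "indep (matroid_restrict M T) I \<longleftrightarrow> I \<subseteq> T \<and> indep M I"
proof
  assume "indep (matroid_restrict M T) I"
  then obtain B where "B \<in> bases (matroid_restrict M T)" "I \<subseteq> B"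
    by (auto simp: indep_def)
  then show "I \<subseteq> T \<and> indep M I"
    by (auto simp: bases_restrict_iff[OF assms] intro: indep_subset)
next
  assume "I \<subseteq> T \<and> indep M I"
  then have I: "I \<subseteq> T" "indep M I" by simp_all
  obtain J where J: "I \<subseteq> J" "J \<subseteq> T" "indep M J" "card J = rank M T"
    using indep_extend[OF M \<open>finite T\<close> I] .
  have "J \<in> bases (matroid_restrict M T)"
    using J by (simp add: bases_restrict_iff[OF assms])
  with J(1) show "indep (matroid_restrict M T) I"
    by (auto simp: indep_def)
qed

section \<open>Rank functions of restriction and contraction\<close>

lemma rank_restrict:
  assumes "matroid M" "finite T" "X \<subseteq> T"
  shows "rank (matroid_restrict M T) X = rank M X"
proof -
  have "{I. I \<subseteq> X \<and> indep (matroid_restrict M T) I} = {I. I \<subseteq> X \<and> indep M I}"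
    using assms by (auto simp: indep_restrict_iff)
  then show ?thesis unfolding rank_def by simp
qed

lemma indep_contract_iff:
  "indep (matroid_contract M T) I \<longleftrightarrow>
     (\<exists>B \<in> bases M. B \<inter> T \<in> bases (matroid_restrict M T) \<and> I \<subseteq> B - T)"
  unfolding indep_def matroid_contract_def by auto

text \<open>For \<open>\<le>\<close>, a maximum independent subset of \<open>T\<close> is extended
  within \<open>T \<union> X\<close>, and the part added outside \<open>T\<close> is independent in
  the contraction. For \<open>\<ge>\<close>, an independent set of the contraction is joined to the
  trace on \<open>T\<close> of its witnessing basis.\<close>

lemma rank_contract:
  assumes M: "matroid M" and fin: "finite T" "finite X"
  shows "rank M (T \<union> X) = rank M T + rank (matroid_contract M T) X"
proof (rule le_antisym)
  obtain I0 where I0: "I0 \<subseteq> T" "indep M I0" "card I0 = rank M T"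
    using rank_witness[OF M fin(1)] .
  obtain J where J: "I0 \<subseteq> J" "J \<subseteq> T \<union> X" "indep M J" "card J = rank M (T \<union> X)"
    using indep_extend[OF M finite_UnI[OF fin] le_supI1[OF I0(1)] I0(2)] .
  have finJ: "finite J"
    using M J(3) by (rule indep_finite)
  obtain B where B: "B \<in> bases M" "J \<subseteq> B"
    using J(3) unfolding indep_def by blast
  \<comment> \<open>\<open>I0\<close> already has full rank in \<open>T\<close>, so no independent
    subset of \<open>T\<close> properly contains it. Applied to the traces of \<open>J\<close> and
    \<open>B\<close> on \<open>T\<close>, this makes \<open>B\<close> the witness that
    \<open>indep_contract_iff\<close> asks for.\<close>
  have sat: "K = I0" if "I0 \<subseteq> K" "K \<subseteq> T" "indep M K" for K
    using card_seteq[OF indep_finite[OF M that(3)] that(1)] I0(3) card_le_rank[OF fin(1) that(2,3)]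
    by simp
  have "B \<inter> T = I0"
    using B I0(1) J(1) indep_subset[OF indep_basis[OF B(1)]] by (intro sat) auto
  moreover have "J \<inter> T = I0"
    using I0(1) J(1) indep_subset[OF J(3)] by (intro sat) auto
  moreover have "I0 \<in> bases (matroid_restrict M T)"
    using I0 by (simp add: bases_restrict_iff[OF M fin(1)])
  ultimately have "indep (matroid_contract M T) (J - T)"
    unfolding indep_contract_iff using B by auto
  then have "card (J - T) \<le> rank (matroid_contract M T) X"
    using J(2) by (intro card_le_rank fin) auto
  moreover have "card J = card (J \<inter> T) + card (J - T)"
    using finJ by (metis card_Int_Diff)
  ultimately show "rank M (T \<union> X) \<le> rank M T + rank (matroid_contract M T) X"
    using J(4) I0(3) \<open>J \<inter> T = I0\<close> by simp
  \<comment> \<open>\<open>rank_witness\<close> would ask for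
    \<open>matroid (matroid_contract M T)\<close>. For the maximum to be attained it is enough that
    the contraction has some independent set, and the empty set is one.\<close>
  have "indep (matroid_contract M T) {}"
    using \<open>indep (matroid_contract M T) (J - T)\<close> by (rule indep_subset) simp
  then have "rank (matroid_contract M T) X \<in> card ` {I. I \<subseteq> X \<and> indep (matroid_contract M T) I}"
    unfolding rank_def using finite_indep_subsets[OF fin(2), of "matroid_contract M T"]
    by (intro Max_in) auto
  then obtain I where I: "I \<subseteq> X" "indep (matroid_contract M T) I"
      "card I = rank (matroid_contract M T) X"
    by auto
  then obtain B' where B': "B' \<in> bases M" "B' \<inter> T \<in> bases (matroid_restrict M T)" "I \<subseteq> B' - T"
    unfolding indep_contract_iff by blast
  \<comment> \<open>\<open>B' \<inter> T\<close> and \<open>I\<close> are disjoint parts of the same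
    basis \<open>B'\<close>, so their sizes add and their union is independent.\<close>
  have "card (B' \<inter> T \<union> I) = card (B' \<inter> T) + card I"
    using B'(3) matroid_finite_basis[OF M B'(1)] by (intro card_Un_disjoint) (auto intro: finite_subset)
  moreover have "card (B' \<inter> T \<union> I) \<le> rank M (T \<union> X)"
    using B'(3) I(1) by (intro card_le_rank indep_subset[OF indep_basis[OF B'(1)]]) (auto simp: fin)
  ultimately show "rank M T + rank (matroid_contract M T) X \<le> rank M (T \<union> X)"
    using B'(2) I(3) by (simp add: bases_restrict_iff[OF M fin(1)])
qed

subsection \<open>Laurent monomials\<close>

text \<open>The exponent map inside \<open>set_to_one\<close>, named so that its additivity can be
  applied to products of monomials.\<close>

definition drop_vars :: "'e set \<Rightarrow> ('e \<Rightarrow>\<^sub>0 int) \<Rightarrow> 'e \<Rightarrow>\<^sub>0 int" where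
  "drop_vars A = Poly_Mapping.mapp (\<lambda>e a. if e \<in> A then 0 else a)"

lemma lookup_drop_vars:
  "Poly_Mapping.lookup (drop_vars A m) e = (if e \<in> A then 0 else Poly_Mapping.lookup m e)"
  by (simp add: drop_vars_def lookup_mapp when_def in_keys_iff)

lemma drop_vars_add: "drop_vars A (m + m') = drop_vars A m + drop_vars A m'"
  by (rule poly_mapping_eqI) (simp add: lookup_drop_vars lookup_add)

lemma set_to_one_single:
  "set_to_one A (Poly_Mapping.single m c) = Poly_Mapping.single (drop_vars A m) c"
  by (simp add: set_to_one_def drop_vars_def)

lemma set_to_one_monomial: "set_to_one A (monomial m) = monomial (drop_vars A m)"
  by (simp add: monomial_def set_to_one_single)

lemma set_to_one_add: "set_to_one A (p + q) = set_to_one A p + set_to_one A q"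
  unfolding set_to_one_def by (rule setsum_keys_plus_distrib) (simp_all add: single_add)

lemma set_to_one_diff: "set_to_one A (p - q) = set_to_one A p - set_to_one A q"
  using set_to_one_add[of A "p - q" q] by simp

text \<open>The instance of multiplicativity that wall crossing needs: \<open>var a\<close>
  specialises to 1. Building \<open>q\<close> term by term reduces it to single terms, where only
  the exponent of \<open>a\<close> changes and \<open>drop_vars\<close> erases it.\<close>

lemma set_to_one_var_mult:
  assumes "a \<in> A"
  shows "set_to_one A (var a * q) = set_to_one A q"
proof (induction q rule: update_induct)
  case const
  then show ?case by simp
next
  case (update q m c)
  \<comment> \<open>\<open>m\<close> is not a key of \<open>q\<close>, so overwriting its
    coefficient amounts to adding a term.\<close>
  have eq: "Poly_Mapping.update m c q = q + Poly_Mapping.single m c"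
    using update(1) by (intro poly_mapping_eqI)
      (auto simp: lookup_update lookup_add lookup_single when_def in_keys_iff)
  have "drop_vars A (Poly_Mapping.single a 1) = 0"
    using assms by (intro poly_mapping_eqI) (simp add: lookup_drop_vars lookup_single when_def)
  then have "set_to_one A (var a * Poly_Mapping.single m c) = set_to_one A (Poly_Mapping.single m c)"
    by (simp add: var_def monomial_def mult_single set_to_one_single drop_vars_add)
  then show ?case
    by (simp add: eq distrib_left set_to_one_add update)
qed

text \<open>
  Thus crossing the wall \<open>x\<^sub>a = x\<^sub>b\<close> leaves the exponents of all other variables of a
  piecewise Laurent monomial unchanged.
\<close>

lemma set_to_one_eq_if_dvd_diff:
  assumes "a \<in> A" "b \<in> A" "p - p' = (var a - var b) * q"
  shows "set_to_one A p = set_to_one A p'"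
proof -
  have "set_to_one A (p - p') = 0"
    using assms by (simp add: left_diff_distrib set_to_one_diff set_to_one_var_mult)
  then show ?thesis by (simp add: set_to_one_diff)
qed

text \<open>The two exponent vectors are complementary parts of \<open>m\<close>. Such a
  factorisation is special to monomials. The condition on \<open>keys m\<close> excludes variables
  outside both \<open>E\<close> and \<open>T\<close>, whose exponents would be counted
  twice.\<close>

lemma set_to_one_split:
  assumes "Poly_Mapping.keys m \<subseteq> E"
  shows "set_to_one (E - T) (monomial m) * set_to_one T (monomial m) = monomial m"
proof -
  have "drop_vars (E - T) m + drop_vars T m = m"
    using assms by (intro poly_mapping_eqI) (auto simp: lookup_drop_vars lookup_add in_keys_iff)
  then show ?thesis
    by (simp add: set_to_one_monomial) (simp add: monomial_def mult_single)
qed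

lemma monomial_inject: "monomial m = monomial m' \<longleftrightarrow> m = m'"
proof
  assume "monomial m = monomial m'"
  then have "Poly_Mapping.keys (monomial m) = Poly_Mapping.keys (monomial m')"
    by (rule arg_cong)
  then show "m = m'" by (simp add: monomial_def)
qed simp

lemma var_inject: "var a = var b \<longleftrightarrow> a = b"
proof
  assume "var a = var b"
  then have "Poly_Mapping.keys (Poly_Mapping.single a (1::int)) = Poly_Mapping.keys (Poly_Mapping.single b (1::int))"
    by (simp add: var_def monomial_inject)
  then show "a = b" by simp
qed simp

lemma var_mult_var_inv: "var e * var_inv e = 1"
  by (simp add: var_def var_inv_def monomial_def mult_single flip: single_add)

lemma rvar_nonzero: "rvar e \<noteq> 0"
  by (metis mult_zero_left to_fract_0 to_fract_1 to_fract_mult var_mult_var_inv zero_neq_one)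

lemma to_fract_var_inv: "to_fract (var_inv e) = 1 / rvar e"
  using rvar_nonzero[of e] by (simp add: nonzero_eq_divide_eq mult.commute var_mult_var_inv flip: to_fract_mult)

subsection \<open>Orderings\<close>

lemma ordering_in: "\<sigma> \<in> orderings E \<Longrightarrow> i \<in> {1..card E} \<Longrightarrow> \<sigma> i \<in> E"
  unfolding orderings_def by blast

lemma ordering_bij: "\<sigma> \<in> orderings E \<Longrightarrow> bij_betw \<sigma> {1..card E} E"
  unfolding orderings_def by blast

lemma ordering_inj: "\<sigma> \<in> orderings E \<Longrightarrow> inj_on \<sigma> {1..card E}"
  by (meson bij_betw_imp_inj_on ordering_bij)

lemma ordering_undefined: "\<sigma> \<in> orderings E \<Longrightarrow> i \<notin> {1..card E} \<Longrightarrow> \<sigma> i = undefined"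
  unfolding orderings_def by (auto simp: PiE_def extensional_def)

lemma orderings_eqI:
  "\<sigma> \<in> orderings E \<Longrightarrow> \<tau> \<in> orderings E \<Longrightarrow> (\<And>i. i \<in> {1..card E} \<Longrightarrow> \<sigma> i = \<tau> i) \<Longrightarrow> \<sigma> = \<tau>"
  by (metis ext ordering_undefined)

lemma orderingsI:
  "bij_betw \<sigma> {1..card E} E \<Longrightarrow> (\<And>i. i \<notin> {1..card E} \<Longrightarrow> \<sigma> i = undefined) \<Longrightarrow> \<sigma> \<in> orderings E"
  unfolding orderings_def by (auto simp: PiE_def extensional_def bij_betw_def)

lemma finite_orderings: "finite E \<Longrightarrow> finite (orderings E)"
  unfolding orderings_def by (simp add: finite_PiE)

section \<open>Permuting the positions of an ordering\<close>

lemma ordering_comp_permutes: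
  assumes "\<sigma> \<in> orderings E" "p permutes {1..card E}"
  shows "\<sigma> \<circ> p \<in> orderings E"
proof (rule orderingsI)
  show "bij_betw (\<sigma> \<circ> p) {1..card E} E"
    using assms ordering_bij permutes_imp_bij by (blast intro: bij_betw_trans)
  show "(\<sigma> \<circ> p) i = undefined" if "i \<notin> {1..card E}" for i
    using that ordering_undefined[OF assms(1)] permutes_not_in[OF assms(2) that] by simp
qed

text \<open>A transposition is a product of adjacent ones within the same interval. The ordering is
  generalised in the induction because the induction hypothesis is applied to an ordering that has
  already been swapped.\<close>

lemma transpose_invariant:
  fixes g :: "(nat \<Rightarrow> 'e) \<Rightarrow> 'c"
  assumes adj: "\<And>\<sigma> i. \<sigma> \<in> orderings E \<Longrightarrow> i \<in> {a..<b} \<Longrightarrow> g (\<sigma> \<circ> transpose i (i + 1)) = g \<sigma>"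
    and sub: "{a..b} \<subseteq> {1..card E}"
  shows "\<sigma> \<in> orderings E \<Longrightarrow> a \<le> i \<Longrightarrow> i < j \<Longrightarrow> j \<le> b \<Longrightarrow> g (\<sigma> \<circ> transpose i j) = g \<sigma>"
proof (induction j arbitrary: \<sigma>)
  case 0
  then show ?case by simp
next
  case (Suc j)
  show ?case
  proof (cases "i = j")
    case True
    then have "g (\<sigma> \<circ> transpose i (i + 1)) = g \<sigma>"
      using Suc.prems by (intro adj) auto
    then show ?thesis using True by (simp only: Suc_eq_plus1)
  next
    case False
    have perm: "\<tau> \<circ> transpose k l \<in> orderings E"
      if "\<tau> \<in> orderings E" "k \<in> {a..b}" "l \<in> {a..b}" for \<tau> k l
      using that sub by (intro ordering_comp_permutes permutes_swap_id) auto
    \<comment> \<open>Conjugating by the last adjacent swap moves the upper end from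
      \<open>j\<close> to \<open>Suc j\<close>. The identity fails for \<open>i = j\<close>, hence
      the separate case.\<close>
    have "transpose i (Suc j) = transpose j (Suc j) \<circ> transpose i j \<circ> transpose j (Suc j)"
      using False Suc.prems by (auto simp: fun_eq_iff transpose_def)
    then have "g (\<sigma> \<circ> transpose i (Suc j)) =
        g (((\<sigma> \<circ> transpose j (j + 1)) \<circ> transpose i j) \<circ> transpose j (j + 1))"
      by (simp add: comp_assoc)
    also have "\<dots> = g ((\<sigma> \<circ> transpose j (j + 1)) \<circ> transpose i j)"
      using False Suc.prems by (intro adj perm) auto
    also have "\<dots> = g (\<sigma> \<circ> transpose j (j + 1))"
      using False Suc.prems by (intro Suc.IH perm) auto
    also have "\<dots> = g \<sigma>"
      using False Suc.prems by (intro adj) auto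
    finally show ?thesis .
  qed
qed

text \<open>Transpositions generate the permutations of the interval. Each step absorbs one
  transposition into the ordering, so the statement proved by induction quantifies over all
  orderings.\<close>

lemma permutes_invariant:
  fixes g :: "(nat \<Rightarrow> 'e) \<Rightarrow> 'c"
  assumes adj: "\<And>\<sigma> i. \<sigma> \<in> orderings E \<Longrightarrow> i \<in> {a..<b} \<Longrightarrow> g (\<sigma> \<circ> transpose i (i + 1)) = g \<sigma>"
    and sub: "{a..b} \<subseteq> {1..card E}" and p: "p permutes {a..b}" and \<sigma>: "\<sigma> \<in> orderings E"
  shows "g (\<sigma> \<circ> p) = g \<sigma>"
proof -
  have "\<forall>\<sigma> \<in> orderings E. g (\<sigma> \<circ> p) = g \<sigma>"
    using p finite_atLeastAtMost
  proof (induction rule: permutes_induct)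
    case id
    then show ?case by simp
  next
    case (swap k l p)
    show ?case
    proof
      fix \<sigma> assume \<sigma>: "\<sigma> \<in> orderings E"
      then have "\<sigma> \<circ> transpose k l \<in> orderings E"
        using swap(1,2) sub by (intro ordering_comp_permutes permutes_swap_id) auto
      then have "g ((\<sigma> \<circ> transpose k l) \<circ> p) = g (\<sigma> \<circ> transpose k l)"
        using swap by blast
      also have "\<dots> = g \<sigma>"
      proof (cases "k < l")
        case True
        then show ?thesis using transpose_invariant[where g = g, OF adj sub \<sigma>] swap by simp
      next
        case False
        then show ?thesis using transpose_invariant[where g = g, OF adj sub \<sigma>, of l k] swap
          by (simp add: transpose_commute)
      qed
      finally show "g (\<sigma> \<circ> (transpose k l \<circ> p)) = g \<sigma>"
        by (simp add: comp_assoc)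
    qed
  qed
  then show ?thesis using \<sigma> by blast
qed

text \<open>
  The hypothesis on adjacent transpositions covers only orderings that map \<open>{a..b}\<close> onto \<open>A\<close>;
  the proof extends \<open>g\<close> by a dummy value so that \<open>permutes_invariant\<close> applies.
\<close>

lemma invariant_if_agree_outside:
  fixes g :: "(nat \<Rightarrow> 'e) \<Rightarrow> 'c"
  assumes adj: "\<And>\<sigma> i. \<sigma> \<in> orderings E \<Longrightarrow> \<sigma> ` {a..b} = A \<Longrightarrow> i \<in> {a..<b} \<Longrightarrow>
      g (\<sigma> \<circ> transpose i (i + 1)) = g \<sigma>"
    and sub: "{a..b} \<subseteq> {1..card E}"
    and \<sigma>: "\<sigma> \<in> orderings E" "\<sigma> ` {a..b} = A" and \<tau>: "\<tau> \<in> orderings E" "\<tau> ` {a..b} = A"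
    and agree: "\<And>i. i \<in> {1..card E} - {a..b} \<Longrightarrow> \<tau> i = \<sigma> i"
  shows "g \<tau> = g \<sigma>"
proof -
  \<comment> \<open>On the block, \<open>p\<close> sends \<open>i\<close> to the position at which
    \<sigma> takes the value \<open>\<tau> i\<close>; it is the identity elsewhere.\<close>
  define p where "p = (\<lambda>i. if i \<in> {a..b} then inv_into {a..b} \<sigma> (\<tau> i) else i)"
  have inj: "inj_on \<sigma> {a..b}" "inj_on \<tau> {a..b}"
    using \<sigma>(1) \<tau>(1) sub by (meson inj_on_subset ordering_inj)+
  have "bij_betw (inv_into {a..b} \<sigma> \<circ> \<tau>) {a..b} {a..b}"
    using inj \<sigma>(2) \<tau>(2) by (intro bij_betw_trans[of _ _ A] bij_betw_inv_into) (auto simp: bij_betw_def)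
  then have "bij_betw p {a..b} {a..b}"
    by (rule bij_betw_cong[THEN iffD1, rotated]) (simp add: p_def)
  then have p: "p permutes {a..b}"
    by (rule bij_imp_permutes) (auto simp: p_def)
  have "\<tau> = \<sigma> \<circ> p"
  proof (rule orderings_eqI[OF \<tau>(1)])
    show "\<sigma> \<circ> p \<in> orderings E"
      using p sub \<sigma>(1) by (meson ordering_comp_permutes permutes_subset)
    show "\<tau> i = (\<sigma> \<circ> p) i" if "i \<in> {1..card E}" for i
    proof (cases "i \<in> {a..b}")
      case True
      then have "\<tau> i \<in> \<sigma> ` {a..b}"
        using \<sigma>(2) \<tau>(2) by blast
      then show ?thesis
        using True by (simp add: p_def f_inv_into_f del: atLeastAtMost_iff)
    next
      case False
      then show ?thesis using that agree[of i] by (auto simp: p_def)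
    qed
  qed
  moreover define h where "h = (\<lambda>\<rho>. if \<rho> ` {a..b} = A then Some (g \<rho>) else None)"
  have "h (\<sigma> \<circ> p) = h \<sigma>"
  proof (rule permutes_invariant[OF _ sub p \<sigma>(1)])
    fix \<rho> i assume *: "\<rho> \<in> orderings E" "i \<in> {a..<b}"
    \<comment> \<open>Swapping two positions of the block preserves its image, so both orderings
      fall into the same branch of \<open>h\<close>.\<close>
    have "(\<rho> \<circ> transpose i (i + 1)) ` {a..b} = \<rho> ` {a..b}"
      using *(2) unfolding image_comp[symmetric] by (subst transpose_image_eq) auto
    then show "h (\<rho> \<circ> transpose i (i + 1)) = h \<rho>"
      unfolding h_def using adj * by simp
  qed
  ultimately show ?thesis
    using \<sigma> \<tau> by (simp add: h_def)
qed

subsection \<open>Splitting orderings at \<open>T\<close>\<close>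

text \<open>An injective map from \<open>card T\<close> positions into the finite set
  \<open>T\<close> is onto.\<close>

lemma orderings_first_iff:
  assumes "finite E" "T \<subseteq> E"
  shows "\<sigma> \<in> orderings_first E T \<longleftrightarrow> \<sigma> \<in> orderings E \<and> \<sigma> ` {1..card T} = T"
proof
  assume "\<sigma> \<in> orderings_first E T"
  then have \<sigma>: "\<sigma> \<in> orderings E" "\<sigma> ` {1..card T} \<subseteq> T"
    unfolding orderings_first_def by auto
  have "card T \<le> card E"
    using assms by (simp add: card_mono)
  then have "inj_on \<sigma> {1..card T}"
    using inj_on_subset[OF ordering_inj[OF \<sigma>(1)], of "{1..card T}"] by auto
  then have "card (\<sigma> ` {1..card T}) = card T"
    by (simp add: card_image)
  then show "\<sigma> \<in> orderings E \<and> \<sigma> ` {1..card T} = T"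
    using \<sigma> finite_subset[OF assms(2,1)] by (simp add: card_subset_eq)
next
  assume "\<sigma> \<in> orderings E \<and> \<sigma> ` {1..card T} = T"
  then show "\<sigma> \<in> orderings_first E T"
    unfolding orderings_first_def by auto
qed

lemma ordering_image_tail:
  assumes "finite E" "T \<subseteq> E" "\<sigma> \<in> orderings E"
  shows "\<sigma> ` {1..card T} = T \<longleftrightarrow> \<sigma> ` {card T + 1..card E} = E - T"
proof -
  have le: "card T \<le> card E"
    using assms by (simp add: card_mono)
  then have "{card T + 1..card E} = {1..card E} - {1..card T}"
    and sub: "{1..card T} \<subseteq> {1..card E}"
    by auto
  then have "\<sigma> ` {card T + 1..card E} = \<sigma> ` {1..card E} - \<sigma> ` {1..card T}"
    using inj_on_image_set_diff[OF ordering_inj[OF assms(3)], of "{1..card E}" "{1..card T}"] by simp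
  moreover have E: "\<sigma> ` {1..card E} = E"
    using ordering_bij[OF assms(3)] by (simp add: bij_betw_def)
  ultimately have "\<sigma> ` {card T + 1..card E} = E - \<sigma> ` {1..card T}"
    by simp
  moreover have "\<sigma> ` {1..card T} \<subseteq> E"
    using E sub by blast
  moreover have "S = T \<longleftrightarrow> E - S = E - T" if "S \<subseteq> E" for S
    using that assms(2) by (metis double_diff order_refl)
  ultimately show ?thesis by simp
qed

lemma orderings_firstD:
  assumes "finite E" "T \<subseteq> E" "\<sigma> \<in> orderings_first E T"
  shows "\<sigma> \<in> orderings E" "\<sigma> ` {1..card T} = T" "\<sigma> ` {card T + 1..card E} = E - T"
proof -
  show \<sigma>: "\<sigma> \<in> orderings E" "\<sigma> ` {1..card T} = T"
    using assms(3) unfolding orderings_first_iff[OF assms(1,2)] by simp_all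
  show "\<sigma> ` {card T + 1..card E} = E - T"
    using ordering_image_tail[OF assms(1,2) \<sigma>(1)] \<sigma>(2) by simp
qed

lemma bij_betw_orderings_first:
  assumes "finite E" "T \<subseteq> E"
  shows "bij_betw (\<lambda>\<sigma>. (ordering_restrict T \<sigma>, ordering_contract E T \<sigma>))
           (orderings_first E T) (orderings T \<times> orderings (E - T))"
proof -
  have le: "card T \<le> card E" and cd: "card (E - T) = card E - card T"
    using assms by (simp_all add: card_mono card_Diff_subset finite_subset)
  \<comment> \<open>The inverse concatenates, shifting the second ordering by \<open>card T\<close>.
    The value \<open>undefined\<close> outside \<open>{1..card E}\<close> keeps the result
    extensional.\<close>
  define join where "join = (\<lambda>(\<pi>, \<rho>) i.
    if i \<in> {1..card T} then \<pi> i
    else if i \<in> {card T + 1..card E} then \<rho> (i - card T) else undefined :: 'a)"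
  show ?thesis
  proof (rule bij_betw_byWitness[where f' = join])
    show "\<forall>\<sigma> \<in> orderings_first E T. join (ordering_restrict T \<sigma>, ordering_contract E T \<sigma>) = \<sigma>"
    proof (intro ballI ext)
      fix \<sigma> i assume "\<sigma> \<in> orderings_first E T"
      then have "\<sigma> \<in> orderings E"
        unfolding orderings_first_def by simp
      then show "join (ordering_restrict T \<sigma>, ordering_contract E T \<sigma>) i = \<sigma> i"
        using le ordering_undefined[of \<sigma> E i]
        by (auto simp: join_def ordering_restrict_def ordering_contract_def)
    qed
    show "\<forall>x \<in> orderings T \<times> orderings (E - T).
        (ordering_restrict T (join x), ordering_contract E T (join x)) = x"
    proof clarify
      fix \<pi> \<rho> assume *: "\<pi> \<in> orderings T" "\<rho> \<in> orderings (E - T)"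
      have "ordering_restrict T (join (\<pi>, \<rho>)) i = \<pi> i" for i
        using ordering_undefined[OF *(1), of i] by (auto simp: join_def ordering_restrict_def)
      moreover have "ordering_contract E T (join (\<pi>, \<rho>)) i = \<rho> i" for i
        using ordering_undefined[OF *(2), of i] le
        by (auto simp: join_def ordering_contract_def cd restrict_def)
      ultimately show "ordering_restrict T (join (\<pi>, \<rho>)) = \<pi> \<and>
          ordering_contract E T (join (\<pi>, \<rho>)) = \<rho>"
        by (simp add: fun_eq_iff)
    qed
    show "(\<lambda>\<sigma>. (ordering_restrict T \<sigma>, ordering_contract E T \<sigma>)) ` orderings_first E T
        \<subseteq> orderings T \<times> orderings (E - T)"
    proof clarify
      fix \<sigma> assume "\<sigma> \<in> orderings_first E T"
      note \<sigma> = orderings_firstD[OF assms this]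
      have inj: "inj_on \<sigma> {1..card T}" "inj_on \<sigma> {card T + 1..card E}"
        using le by (auto intro!: inj_on_subset[OF ordering_inj[OF \<sigma>(1)]])
      have "bij_betw (ordering_restrict T \<sigma>) {1..card T} T"
        using inj(1) \<sigma>(2) by (auto simp: bij_betw_def ordering_restrict_def)
      moreover have "bij_betw (\<lambda>i. i + card T) {1..card E - card T} {card T + 1..card E}"
        by (rule bij_betw_byWitness[where f' = "\<lambda>i. i - card T"]) (use le in auto)
      then have "bij_betw (\<sigma> \<circ> (\<lambda>i. i + card T)) {1..card E - card T} (E - T)"
        by (rule bij_betw_trans) (use inj(2) \<sigma>(3) in \<open>simp add: bij_betw_def\<close>)
      then have "bij_betw (ordering_contract E T \<sigma>) {1..card E - card T} (E - T)"
        by (rule bij_betw_cong[THEN iffD1, rotated]) (simp add: ordering_contract_def)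
      ultimately show "ordering_restrict T \<sigma> \<in> orderings T \<and>
          ordering_contract E T \<sigma> \<in> orderings (E - T)"
        by (intro conjI orderingsI) (auto simp: cd ordering_restrict_def ordering_contract_def)
    qed
    show "join ` (orderings T \<times> orderings (E - T)) \<subseteq> orderings_first E T"
    proof clarify
      fix \<pi> \<rho> assume *: "\<pi> \<in> orderings T" "\<rho> \<in> orderings (E - T)"
      have "bij_betw (join (\<pi>, \<rho>)) {1..card T} T"
        using ordering_bij[OF *(1)]
        by (rule bij_betw_cong[THEN iffD1, rotated]) (simp add: join_def)
      moreover have "bij_betw (\<lambda>i. i - card T) {card T + 1..card E} {1..card E - card T}"
        by (rule bij_betw_byWitness[where f' = "\<lambda>i. i + card T"]) (use le in auto)
      then have "bij_betw (\<rho> \<circ> (\<lambda>i. i - card T)) {card T + 1..card E} (E - T)"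
        by (rule bij_betw_trans) (use ordering_bij[OF *(2)] cd in simp)
      then have "bij_betw (join (\<pi>, \<rho>)) {card T + 1..card E} (E - T)"
        by (rule bij_betw_cong[THEN iffD1, rotated]) (simp add: join_def)
      ultimately have "bij_betw (join (\<pi>, \<rho>)) ({1..card T} \<union> {card T + 1..card E}) (T \<union> (E - T))"
        by (rule bij_betw_combine) simp
      moreover have "{1..card T} \<union> {card T + 1..card E} = {1..card E}" "T \<union> (E - T) = E"
        using le assms(2) by auto
      ultimately have "join (\<pi>, \<rho>) \<in> orderings E"
        using le by (intro orderingsI) (auto simp: join_def)
      moreover have "join (\<pi>, \<rho>) i \<in> T" if "i \<in> {1..card T}" for i
        using ordering_in[OF *(1)] that by (simp add: join_def)
      ultimately show "join (\<pi>, \<rho>) \<in> orderings_first E T"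
        unfolding orderings_first_def by simp
    qed
  qed
qed

section \<open>Well-definedness of the restricted and contracted families\<close>

lemma PLaur_adjacent:
  assumes "f \<in> PLaur E" "\<sigma> \<in> orderings E" "i \<in> {1..card E - 1}" "\<sigma> i \<in> A" "\<sigma> (i + 1) \<in> A"
  shows "set_to_one A (f (\<sigma> \<circ> transpose i (i + 1))) = set_to_one A (f \<sigma>)"
proof -
  have "\<forall>\<sigma> \<in> orderings E. \<forall>i \<in> {1..card E - 1}. \<exists>q \<in> Laurent E.
      f \<sigma> - f (\<sigma> \<circ> transpose i (i + 1)) = (var (\<sigma> i) - var (\<sigma> (i + 1))) * q"
    using assms(1) unfolding PLaur_def mem_Collect_eq by (rule conjunct2)
  from bspec[OF bspec[OF this assms(2)] assms(3)]
  obtain q where "f \<sigma> - f (\<sigma> \<circ> transpose i (i + 1)) = (var (\<sigma> i) - var (\<sigma> (i + 1))) * q"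
    by (rule bexE)
  then show ?thesis
    by (rule set_to_one_eq_if_dvd_diff[OF assms(4,5), symmetric])
qed

text \<open>Two orderings with the same head differ by a permutation of the tail positions, hence by
  adjacent swaps across walls between variables outside \<open>T\<close>. Setting these variables to
  1 hides the swaps, so \<open>THE\<close> has exactly one candidate.\<close>

lemma family_restrict_eq:
  assumes fin: "finite E" "T \<subseteq> E" and f: "f \<in> PLaur E" and \<sigma>: "\<sigma> \<in> orderings_first E T"
  shows "family_restrict E T f (ordering_restrict T \<sigma>) = set_to_one (E - T) (f \<sigma>)"
proof -
  have same: "set_to_one (E - T) (f \<sigma>) = set_to_one (E - T) (f \<tau>)"
    if \<tau>: "\<tau> \<in> orderings_first E T" and eq: "ordering_restrict T \<tau> = ordering_restrict T \<sigma>" for \<tau>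
  proof (rule invariant_if_agree_outside[where g = "\<lambda>\<rho>. set_to_one (E - T) (f \<rho>)"
        and a = "card T + 1" and b = "card E" and A = "E - T"])
    show "set_to_one (E - T) (f (\<rho> \<circ> transpose i (i + 1))) = set_to_one (E - T) (f \<rho>)"
      if "\<rho> \<in> orderings E" "\<rho> ` {card T + 1..card E} = E - T" "i \<in> {card T + 1..<card E}" for \<rho> i
    proof (rule PLaur_adjacent[OF f that(1)])
      show "i \<in> {1..card E - 1}"
        using that(3) by auto
      show "\<rho> i \<in> E - T" "\<rho> (i + 1) \<in> E - T"
        using that(3) by (auto simp flip: that(2))
    qed
    show "\<sigma> i = \<tau> i" if "i \<in> {1..card E} - {card T + 1..card E}" for i
      using fun_cong[OF eq, of i] that by (auto simp: ordering_restrict_def)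
  qed (use orderings_firstD[OF fin \<sigma>] orderings_firstD[OF fin \<tau>] in auto)
  show ?thesis
    unfolding family_restrict_def
  proof (rule the_equality)
    show "\<forall>\<tau> \<in> orderings_first E T. ordering_restrict T \<tau> = ordering_restrict T \<sigma> \<longrightarrow>
        set_to_one (E - T) (f \<sigma>) = set_to_one (E - T) (f \<tau>)"
      by (intro ballI impI) (rule same)
    show "p = set_to_one (E - T) (f \<sigma>)"
      if "\<forall>\<tau> \<in> orderings_first E T. ordering_restrict T \<tau> = ordering_restrict T \<sigma> \<longrightarrow> p = set_to_one (E - T) (f \<tau>)"
      for p
      using bspec[OF that \<sigma>] by simp
  qed
qed

text \<open>The mirror case: the tail is fixed, the head positions are permuted, and the walls
  crossed lie between variables of \<open>T\<close>.\<close>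

lemma family_contract_eq:
  assumes fin: "finite E" "T \<subseteq> E" and f: "f \<in> PLaur E" and \<sigma>: "\<sigma> \<in> orderings_first E T"
  shows "family_contract E T f (ordering_contract E T \<sigma>) = set_to_one T (f \<sigma>)"
proof -
  have le: "card T \<le> card E"
    using fin by (simp add: card_mono)
  have same: "set_to_one T (f \<sigma>) = set_to_one T (f \<tau>)"
    if \<tau>: "\<tau> \<in> orderings_first E T" and eq: "ordering_contract E T \<tau> = ordering_contract E T \<sigma>" for \<tau>
  proof (rule invariant_if_agree_outside[where g = "\<lambda>\<rho>. set_to_one T (f \<rho>)"
        and a = 1 and b = "card T" and A = T])
    show "set_to_one T (f (\<rho> \<circ> transpose i (i + 1))) = set_to_one T (f \<rho>)"
      if "\<rho> \<in> orderings E" "\<rho> ` {1..card T} = T" "i \<in> {1..<card T}" for \<rho> i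
    proof (rule PLaur_adjacent[OF f that(1)])
      show "i \<in> {1..card E - 1}"
        using that(3) le by auto
      show "\<rho> i \<in> T" "\<rho> (i + 1) \<in> T"
        using that(2,3) by auto
    qed
    \<comment> \<open>Position \<open>i\<close> of the full ordering is position
      \<open>i - card T\<close> of the contracted one.\<close>
    show "\<sigma> i = \<tau> i" if "i \<in> {1..card E} - {1..card T}" for i
      using fun_cong[OF eq, of "i - card T"] that
      by (auto simp: ordering_contract_def Suc_le_eq split: if_splits)
  qed (use orderings_firstD[OF fin \<sigma>] orderings_firstD[OF fin \<tau>] le in auto)
  show ?thesis
    unfolding family_contract_def
  proof (rule the_equality)
    show "\<forall>\<tau> \<in> orderings_first E T. ordering_contract E T \<tau> = ordering_contract E T \<sigma> \<longrightarrow>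
        set_to_one T (f \<sigma>) = set_to_one T (f \<tau>)"
      by (intro ballI impI) (rule same)
    show "p = set_to_one T (f \<sigma>)"
      if "\<forall>\<tau> \<in> orderings_first E T. ordering_contract E T \<tau> = ordering_contract E T \<sigma> \<longrightarrow> p = set_to_one T (f \<tau>)"
      for p
      using bspec[OF that \<sigma>] by simp
  qed
qed

section \<open>Splitting the greedy basis and the cone factor\<close>

lemma Collect_image_cong:
  assumes "\<And>i. i \<in> S \<Longrightarrow> g i = h i" "\<And>i. i \<in> S \<Longrightarrow> P i \<longleftrightarrow> Q i"
  shows "{g i |i. i \<in> S \<and> P i} = {h i |i. i \<in> S \<and> Q i}"
  using assms by (intro Collect_cong ex_cong1) auto

text \<open>Greedy elements sit where the rank of the prefix jumps. Prefixes of length at most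
  \<open>card T\<close> lie in \<open>T\<close>, where the restriction has the same ranks. Longer
  prefixes contain \<open>T\<close>, and their ranks exceed those in the contraction by the constant
  \<open>rank M T\<close>, which leaves the jumps unchanged.\<close>

lemma greedy_basis_split:
  assumes M: "matroid M" and E: "ground M = E" and TE: "T \<subseteq> E" and \<sigma>: "\<sigma> \<in> orderings_first E T"
  shows "greedy_basis M \<sigma> = greedy_basis (matroid_restrict M T) (ordering_restrict T \<sigma>) \<union>
           greedy_basis (matroid_contract M T) (ordering_contract E T \<sigma>)"
proof -
  have finE: "finite E" using M E unfolding matroid_def by simp
  then have finT: "finite T" using TE finite_subset by blast
  have le: "card T \<le> card E" and cd: "card (E - T) = card E - card T"
    using finE finT TE by (simp_all add: card_mono card_Diff_subset)
  note \<sigma>' = orderings_firstD[OF finE TE \<sigma>]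
  have head_image: "ordering_restrict T \<sigma> ` {1..i} = \<sigma> ` {1..i}" if "i \<le> card T" for i
    using that by (auto simp: ordering_restrict_def)
  have head: "rank (matroid_restrict M T) (ordering_restrict T \<sigma> ` {1..i}) = rank M (\<sigma> ` {1..i})"
    if "i \<le> card T" for i
  proof -
    have "\<sigma> ` {1..i} \<subseteq> T"
      using that \<sigma>'(2) by fastforce
    then show ?thesis
      using that by (simp only: head_image rank_restrict[OF M finT])
  qed
  have tail_image: "ordering_contract E T \<sigma> ` {1..i} = \<sigma> ` {card T + 1..i + card T}"
    if "i \<le> card E - card T" for i
  proof -
    have "ordering_contract E T \<sigma> ` {1..i} = \<sigma> ` ((\<lambda>j. j + card T) ` {1..i})"
      unfolding image_image using that by (intro image_cong) (auto simp: ordering_contract_def)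
    then show ?thesis by (simp add: add.commute)
  qed
  have tail_rank: "rank M (\<sigma> ` {1..i + card T}) =
      rank M T + rank (matroid_contract M T) (ordering_contract E T \<sigma> ` {1..i})"
    if "i \<le> card E - card T" for i
  proof -
    have "{1..i + card T} = {1..card T} \<union> {card T + 1..i + card T}"
      by auto
    then have "\<sigma> ` {1..i + card T} = T \<union> ordering_contract E T \<sigma> ` {1..i}"
      using \<sigma>'(2) by (simp only: image_Un tail_image[OF that])
    then show ?thesis
      using rank_contract[OF M finT] by simp
  qed
  let ?new = "\<lambda>i. rank M (\<sigma> ` {1..i - 1}) < rank M (\<sigma> ` {1..i})"
  have 1: "greedy_basis (matroid_restrict M T) (ordering_restrict T \<sigma>) =
      {\<sigma> i |i. i \<in> {1..card T} \<and> ?new i}"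
  proof -
    have ground: "ground (matroid_restrict M T) = T"
      by (simp add: matroid_restrict_def)
    show ?thesis
      unfolding greedy_basis_def ground
    proof (rule Collect_image_cong)
      fix i assume i: "i \<in> {1..card T}"
      then have le': "i - 1 \<le> card T" "i \<le> card T" by auto
      show "ordering_restrict T \<sigma> i = \<sigma> i"
        using i by (simp add: ordering_restrict_def)
      show "rank (matroid_restrict M T) (ordering_restrict T \<sigma> ` {1..i - 1})
          < rank (matroid_restrict M T) (ordering_restrict T \<sigma> ` {1..i}) \<longleftrightarrow> ?new i"
        by (simp only: head[OF le'(1)] head[OF le'(2)])
    qed
  qed
  have 2: "greedy_basis (matroid_contract M T) (ordering_contract E T \<sigma>) =
      {\<sigma> i |i. i \<in> {card T + 1..card E} \<and> ?new i}"
  proof -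
    have ground: "ground (matroid_contract M T) = E - T"
      by (simp add: matroid_contract_def E)
    have "greedy_basis (matroid_contract M T) (ordering_contract E T \<sigma>) =
        {\<sigma> (i + card T) |i. i \<in> {1..card E - card T} \<and> ?new (i + card T)}"
      unfolding greedy_basis_def ground cd
    proof (rule Collect_image_cong)
      fix i assume i: "i \<in> {1..card E - card T}"
      then have le': "i - 1 \<le> card E - card T" "i \<le> card E - card T" by auto
      \<comment> \<open>Truncated subtraction makes this depend on \<open>1 \<le> i\<close>. For
        \<open>i = 1\<close> the shorter prefix is \<open>T\<close> itself, matching the empty
        prefix in the contraction.\<close>
      have "i + card T - 1 = (i - 1) + card T"
        using i by auto
      then show "rank (matroid_contract M T) (ordering_contract E T \<sigma> ` {1..i - 1})
          < rank (matroid_contract M T) (ordering_contract E T \<sigma> ` {1..i}) \<longleftrightarrow> ?new (i + card T)"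
        by (simp only: tail_rank[OF le'(1)] tail_rank[OF le'(2)] add_less_cancel_left)
      show "ordering_contract E T \<sigma> i = \<sigma> (i + card T)"
        using i by (simp add: ordering_contract_def)
    qed
    also have "\<dots> = {\<sigma> i |i. i \<in> {card T + 1..card E} \<and> ?new i}"
    proof (intro set_eqI iffI)
      fix x assume "x \<in> {\<sigma> i |i. i \<in> {card T + 1..card E} \<and> ?new i}"
      then obtain i where "x = \<sigma> i" "i \<in> {card T + 1..card E}" "?new i" by blast
      then show "x \<in> {\<sigma> (i + card T) |i. i \<in> {1..card E - card T} \<and> ?new (i + card T)}"
        by (intro CollectI exI[of _ "i - card T"]) auto
    next
      fix x assume "x \<in> {\<sigma> (i + card T) |i. i \<in> {1..card E - card T} \<and> ?new (i + card T)}"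
      then obtain i where "x = \<sigma> (i + card T)" "i \<in> {1..card E - card T}" "?new (i + card T)" by blast
      then show "x \<in> {\<sigma> i |i. i \<in> {card T + 1..card E} \<and> ?new i}"
        using le by (intro CollectI exI[of _ "i + card T"]) auto
    qed
    finally show ?thesis .
  qed
  have "i \<in> {1..card E} \<longleftrightarrow> i \<in> {1..card T} \<or> i \<in> {card T + 1..card E}" for i
    using le by auto
  then show ?thesis
    unfolding 1 2 unfolding greedy_basis_def E by blast
qed

lemma greedy_basis_subset: "\<sigma> \<in> orderings (ground M) \<Longrightarrow> greedy_basis M \<sigma> \<subseteq> ground M"
  unfolding greedy_basis_def using ordering_in by fastforce

text \<open>The denominator of \<open>Q_cone\<close> has one factor for each pair of neighbouring
  positions. Pairs within one block give the denominators of the two smaller cones; only the pair at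
  \<open>card T\<close> and \<open>card T + 1\<close> straddles the border.\<close>

lemma Q_cone_split:
  fixes E :: "'e::linorder set"
  assumes "finite E" "T \<noteq> {}" "T \<subset> E" and \<sigma>: "\<sigma> \<in> orderings E"
  shows "(1 - rvar (\<sigma> (card T + 1)) / rvar (\<sigma> (card T))) * Q_cone E \<sigma> =
           Q_cone T (ordering_restrict T \<sigma>) * Q_cone (E - T) (ordering_contract E T \<sigma>)"
proof -
  have finT: "finite T" using assms finite_subset by blast
  have pos: "1 \<le> card T" and less: "card T < card E" and cd: "card (E - T) = card E - card T"
    using assms finT by (simp_all add: card_gt_0_iff Suc_le_eq psubset_card_mono card_Diff_subset)
  define a where "a = (\<lambda>i. 1 - rvar (\<sigma> (i + 1)) / rvar (\<sigma> i))"
  \<comment> \<open>Distinct variables have a quotient different from 1, so the border factor is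
    nonzero and may be cancelled.\<close>
  have "\<sigma> (card T + 1) \<noteq> \<sigma> (card T)"
    using ordering_inj[OF \<sigma>] pos less by (auto dest!: inj_onD)
  then have nz: "a (card T) \<noteq> 0"
    by (simp add: a_def var_inject rvar_nonzero)
  have "(\<Prod>i \<in> {1..card T - 1}. 1 - rvar (ordering_restrict T \<sigma> (i + 1)) / rvar (ordering_restrict T \<sigma> i))
      = prod a {1..card T - 1}"
    by (intro prod.cong) (auto simp: a_def ordering_restrict_def)
  then have 1: "Q_cone T (ordering_restrict T \<sigma>) = 1 / prod a {1..card T - 1}"
    unfolding Q_cone_def by simp
  have "(\<Prod>i \<in> {1..card E - card T - 1}.
        1 - rvar (ordering_contract E T \<sigma> (i + 1)) / rvar (ordering_contract E T \<sigma> i))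
      = (\<Prod>i \<in> {1..card E - card T - 1}. a (i + card T))"
    by (intro prod.cong) (auto simp: a_def ordering_contract_def)
  also have "\<dots> = prod a {card T + 1..card E - 1}"
    by (rule prod.reindex_bij_witness[where i = "\<lambda>i. i - card T" and j = "\<lambda>i. i + card T"])
      (use less in auto)
  finally have 2: "Q_cone (E - T) (ordering_contract E T \<sigma>) = 1 / prod a {card T + 1..card E - 1}"
    unfolding Q_cone_def cd by simp
  \<comment> \<open>The left range is empty when \<open>T\<close> is a singleton, the right one when
    \<open>E - T\<close> is; the corresponding product is then 1.\<close>
  have "{1..card E - 1} = {1..card T - 1} \<union> insert (card T) {card T + 1..card E - 1}"
    using pos less by auto
  then have "prod a {1..card E - 1} =
      prod a {1..card T - 1} * prod a (insert (card T) {card T + 1..card E - 1})"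
    by (simp only:) (rule prod.union_disjoint, use pos in auto)
  also have "prod a (insert (card T) {card T + 1..card E - 1}) =
      a (card T) * prod a {card T + 1..card E - 1}"
    by simp
  finally have 3: "Q_cone E \<sigma> =
      1 / (prod a {1..card T - 1} * (a (card T) * prod a {card T + 1..card E - 1}))"
    unfolding Q_cone_def a_def by simp
  have "a (card T) * Q_cone E \<sigma> = Q_cone T (ordering_restrict T \<sigma>) * Q_cone (E - T) (ordering_contract E T \<sigma>)"
    unfolding 1 2 3 using nz by simp
  then show ?thesis unfolding a_def .
qed

subsection \<open>The recursion\<close>

lemma Q_summand_split:
  fixes M :: "'e::linorder set_system"
  assumes M: "matroid M" and E: "ground M = E" and f: "f \<in> PLaur_monomials E"
    and T: "T \<noteq> {}" "T \<subset> E" and \<sigma>: "\<sigma> \<in> orderings_first E T"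
  shows "(to_fract (f \<sigma>) - to_fract (family_twist E T f \<sigma>)) * Q_cone E \<sigma> *
           (\<Prod>e \<in> E - greedy_basis M \<sigma>. 1 - rvar e) =
         (to_fract (family_restrict E T f (ordering_restrict T \<sigma>)) * Q_cone T (ordering_restrict T \<sigma>) *
           (\<Prod>e \<in> T - greedy_basis (matroid_restrict M T) (ordering_restrict T \<sigma>). 1 - rvar e)) *
         (to_fract (family_contract E T f (ordering_contract E T \<sigma>)) * Q_cone (E - T) (ordering_contract E T \<sigma>) *
           (\<Prod>e \<in> E - T - greedy_basis (matroid_contract M T) (ordering_contract E T \<sigma>). 1 - rvar e))"
    (is "_ * ?P = (?r * ?Qr * ?Pr) * (?c * ?Qc * ?Pc)")
proof -
  have finE: "finite E" using M E unfolding matroid_def by simp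
  have TE: "T \<subseteq> E" using T by blast
  have \<sigma>': "\<sigma> \<in> orderings E"
    using \<sigma> unfolding orderings_first_def by simp
  have PL: "f \<in> PLaur E"
    using f unfolding PLaur_monomials_def by simp
  obtain m where m: "Poly_Mapping.keys m \<subseteq> E" "f \<sigma> = monomial m"
    using f \<sigma>' unfolding PLaur_monomials_def by blast
  \<comment> \<open>Here it matters that \<open>f \<sigma>\<close> is a monomial and not merely a
    Laurent polynomial.\<close>
  have rc: "?r * ?c = to_fract (f \<sigma>)"
    unfolding family_restrict_eq[OF finE TE PL \<sigma>] family_contract_eq[OF finE TE PL \<sigma>] m(2)
      to_fract_mult[symmetric] set_to_one_split[OF m(1)] ..
  \<comment> \<open>This confines each smaller greedy basis to its own block, so that the complement
    of their union splits into the complements within the blocks.\<close>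
  have mem: "ordering_restrict T \<sigma> \<in> orderings T" "ordering_contract E T \<sigma> \<in> orderings (E - T)"
    using bij_betwE[OF bij_betw_orderings_first[OF finE TE]] \<sigma> by auto
  have "greedy_basis (matroid_restrict M T) (ordering_restrict T \<sigma>) \<subseteq> T"
    using greedy_basis_subset[of _ "matroid_restrict M T"] mem(1) by (simp add: matroid_restrict_def)
  moreover have "greedy_basis (matroid_contract M T) (ordering_contract E T \<sigma>) \<subseteq> E - T"
    using greedy_basis_subset[of _ "matroid_contract M T"] mem(2) by (simp add: matroid_contract_def E)
  ultimately have "E - greedy_basis M \<sigma> =
      (T - greedy_basis (matroid_restrict M T) (ordering_restrict T \<sigma>)) \<union>
      (E - T - greedy_basis (matroid_contract M T) (ordering_contract E T \<sigma>))"
    unfolding greedy_basis_split[OF M E TE \<sigma>] using TE by blast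
  then have P: "?P = ?Pr * ?Pc"
    by (simp only:) (rule prod.union_disjoint, use finE finite_subset[OF TE finE] in auto)
  have "family_twist E T f \<sigma> = var (\<sigma> (card T + 1)) * var_inv (\<sigma> (card T)) * f \<sigma>"
    using \<sigma> by (simp add: family_twist_def)
  then have "to_fract (f \<sigma>) - to_fract (family_twist E T f \<sigma>) =
      to_fract (f \<sigma>) * (1 - rvar (\<sigma> (card T + 1)) / rvar (\<sigma> (card T)))"
    by (simp add: to_fract_var_inv algebra_simps)
  then have "(to_fract (f \<sigma>) - to_fract (family_twist E T f \<sigma>)) * Q_cone E \<sigma> =
      to_fract (f \<sigma>) * (?Qr * ?Qc)"
    by (simp only: mult.assoc Q_cone_split[OF finE T \<sigma>'])
  then show ?thesis
    by (simp only: P rc[symmetric] mult_ac)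
qed

lemma Q_matroid_recursion:
  fixes M :: "'e::linorder set_system"
  assumes M: "matroid M" and E: "ground M = E" and f: "f \<in> PLaur_monomials E"
    and T: "T \<noteq> {}" "T \<subset> E"
  shows "Q_matroid M f = Q_matroid M (family_twist E T f) +
           Q_matroid (matroid_restrict M T) (family_restrict E T f) *
           Q_matroid (matroid_contract M T) (family_contract E T f)"
proof -
  have finE: "finite E" using M E unfolding matroid_def by simp
  have TE: "T \<subseteq> E" using T by blast
  define R where "R = (\<lambda>\<pi>. to_fract (family_restrict E T f \<pi>) * Q_cone T \<pi> *
    (\<Prod>e \<in> T - greedy_basis (matroid_restrict M T) \<pi>. 1 - rvar e))"
  define C where "C = (\<lambda>\<pi>. to_fract (family_contract E T f \<pi>) * Q_cone (E - T) \<pi> *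
    (\<Prod>e \<in> E - T - greedy_basis (matroid_contract M T) \<pi>. 1 - rvar e))"
  define S where "S = (\<lambda>\<sigma>. (to_fract (f \<sigma>) - to_fract (family_twist E T f \<sigma>)) * Q_cone E \<sigma> *
    (\<Prod>e \<in> E - greedy_basis M \<sigma>. 1 - rvar e))"
  \<comment> \<open>Both sums carry the same cone and basis factors, so only the values of the two
    families are subtracted.\<close>
  have "Q_matroid M f - Q_matroid M (family_twist E T f) = (\<Sum>\<sigma> \<in> orderings E. S \<sigma>)"
    unfolding Q_matroid_def E S_def by (simp only: sum_subtractf[symmetric] left_diff_distrib)
  also have "\<dots> = (\<Sum>\<sigma> \<in> orderings_first E T. S \<sigma>)"
    by (rule sum.mono_neutral_right)
      (auto simp: finite_orderings finE S_def family_twist_def orderings_first_def)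
  also have "\<dots> = (\<Sum>\<sigma> \<in> orderings_first E T.
      R (ordering_restrict T \<sigma>) * C (ordering_contract E T \<sigma>))"
    unfolding S_def R_def C_def by (rule sum.cong[OF refl Q_summand_split[OF M E f T]])
  \<comment> \<open>Heads and tails range independently over the full product, which is what lets
    the sum factor.\<close>
  also have "\<dots> = (\<Sum>(\<pi>, \<rho>) \<in> orderings T \<times> orderings (E - T). R \<pi> * C \<rho>)"
    using sum.reindex_bij_betw[OF bij_betw_orderings_first[OF finE TE], of "\<lambda>(\<pi>, \<rho>). R \<pi> * C \<rho>"]
    by simp
  also have "\<dots> = (\<Sum>\<pi> \<in> orderings T. R \<pi>) * (\<Sum>\<rho> \<in> orderings (E - T). C \<rho>)"
    by (simp add: sum_product sum.cartesian_product)
  also have "(\<Sum>\<pi> \<in> orderings T. R \<pi>) = Q_matroid (matroid_restrict M T) (family_restrict E T f)"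
    by (simp add: Q_matroid_def R_def matroid_restrict_def)
  also have "(\<Sum>\<rho> \<in> orderings (E - T). C \<rho>) = Q_matroid (matroid_contract M T) (family_contract E T f)"
    by (simp add: Q_matroid_def C_def matroid_contract_def E)
  finally show ?thesis by (simp add: algebra_simps)
qed

theorem theorem1p2:
  fixes n :: nat and M :: "nat set_system" and f :: "nat family" and T :: "nat set"
  assumes "matroid M" and "ground M = {1..n}"
    and "f \<in> PLaur_monomials {1..n}"
    and "T \<noteq> {}" and "T \<subset> {1..n}"
  shows "Q_matroid M f =
           Q_matroid M (family_twist {1..n} T f) +
           Q_matroid (matroid_restrict M T) (family_restrict {1..n} T f) *
           Q_matroid (matroid_contract M T) (family_contract {1..n} T f)"
  using assms by (rule Q_matroid_recursion)

end
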